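(* Let $M\in\mathbb{R}^{n\times n}$, $Q\in\mathbb{R}^{n\times m}$, $A\in\mathbb{R}^{p\times n}$, $B\in\mathbb{R}^{p\times m}$, $r\in\mathbb{R}^n$, $b\in\mathbb{R}^p$, and let $(x^*,z^* )$ be the solution provided by P-ReCR-SLCC (an optimal solution of $\min\{c_x^Tx+c_z^Tz : Mx+Qz\ge r,\ Ax+Bz=b,\ x,z\ge 0\}$ for some $(c_x,c_z)$). Let $$\mathcal I_+=\{i\in\{1,\dots,n\}:\ x^*_i>0,\ (Mx^*+Qz^*-r)_i>0\}=\{i_1,\dots,i_s\},\qquad s=|\mathcal I_+|.$$ If the SLCC is feasible, then there exists a binary vector $\delta\in\{0,1\}^{|\mathcal I_+|}$ such that the corresponding branch problem $\mathrm{B}(\delta)$ is feasible. If all branch problems $\mathrm{B}(\delta)$, $\delta\in\{0,1\}^{|\mathcal I_+|}$, are infeasible, then the SLCC is infeasible.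
   Context: The SLCC is the system $Mx+Qz-r\ge 0$, $Ax+Bz=b$, $x^T(Mx+Qz-r)=0$, $x,z\ge 0$ in $(x,z)\in\mathbb{R}^n\times\mathbb{R}^m$; it is feasible if some $(x,z)$ satisfies it. For $\delta\in\{0,1\}^s$, the branch problem $\mathrm{B}(\delta)$ is the linear feasibility problem $$\min\ 0\quad\text{s.t.}\quad Mx+Qz\ge r,\ x,z\ge 0,\ Ax+Bz=b,\quad x_{i_\ell}=0\ \text{ if }\delta_\ell=0,\quad (Mx+Qz-r)_{i_\ell}=0\ \text{ if }\delta_\ell=1,\quad \ell=1,\dots,s.$$ P-ReCR-SLCC is an iterative method producing optimal solutions of the linear programs mentioned in the claim with successively updated cost vectors; only the point $(x^*,z^* )$ it returns enters the statement. *)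

theory Defs
  imports "Jordan_Normal_Form.Matrix"
begin

text \<open>
  Vectors and matrices carry their dimensions as natural numbers, so any of the dimensions may be
  \<open>0\<close> (in particular, a system without equality constraints is covered). Components are indexed
  from \<open>0\<close>. The order on vectors is componentwise and includes equality of the dimensions.
\<close>

type_synonym point = "real vec \<times> real vec"

definition residual :: "real mat \<Rightarrow> real mat \<Rightarrow> real vec \<Rightarrow> real vec \<Rightarrow> real vec \<Rightarrow> real vec" where
  "residual M Q r x z = M *\<^sub>v x + Q *\<^sub>v z - r"

text \<open>The feasible region of the linear relaxation (complementarity dropped).\<close>

definition relaxed_region ::
  "nat \<Rightarrow> nat \<Rightarrow> real mat \<Rightarrow> real mat \<Rightarrow> real mat \<Rightarrow> real mat \<Rightarrow> real vec \<Rightarrow> real vec \<Rightarrow> point set" where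
  "relaxed_region n m M Q A B r b =
     {(x, z). x \<in> carrier_vec n \<and> z \<in> carrier_vec m \<and>
        r \<le> M *\<^sub>v x + Q *\<^sub>v z \<and>
        A *\<^sub>v x + B *\<^sub>v z = b \<and>
        0\<^sub>v n \<le> x \<and> 0\<^sub>v m \<le> z}"

definition slcc_solutions ::
  "nat \<Rightarrow> nat \<Rightarrow> real mat \<Rightarrow> real mat \<Rightarrow> real mat \<Rightarrow> real mat \<Rightarrow> real vec \<Rightarrow> real vec \<Rightarrow> point set" where
  "slcc_solutions n m M Q A B r b =
     {(x, z). x \<in> carrier_vec n \<and> z \<in> carrier_vec m \<and>
        0\<^sub>v n \<le> residual M Q r x z \<and>
        A *\<^sub>v x + B *\<^sub>v z = b \<and>
        x \<bullet> residual M Q r x z = 0 \<and>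
        0\<^sub>v n \<le> x \<and> 0\<^sub>v m \<le> z}"

definition slcc_feasible ::
  "nat \<Rightarrow> nat \<Rightarrow> real mat \<Rightarrow> real mat \<Rightarrow> real mat \<Rightarrow> real mat \<Rightarrow> real vec \<Rightarrow> real vec \<Rightarrow> bool" where
  "slcc_feasible n m M Q A B r b \<longleftrightarrow> slcc_solutions n m M Q A B r b \<noteq> {}"

definition is_minimizer :: "('a \<Rightarrow> real) \<Rightarrow> 'a set \<Rightarrow> 'a \<Rightarrow> bool" where
  "is_minimizer f F p \<longleftrightarrow> p \<in> F \<and> (\<forall>q\<in>F. f p \<le> f q)"

definition lp_optimal ::
  "nat \<Rightarrow> nat \<Rightarrow> real mat \<Rightarrow> real mat \<Rightarrow> real mat \<Rightarrow> real mat \<Rightarrow> real vec \<Rightarrow> real vec \<Rightarrow>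
   real vec \<Rightarrow> real vec \<Rightarrow> point \<Rightarrow> bool" where
  "lp_optimal n m M Q A B r b cx cz p \<longleftrightarrow>
     is_minimizer (\<lambda>(x, z). cx \<bullet> x + cz \<bullet> z) (relaxed_region n m M Q A B r b) p"

definition I_plus ::
  "nat \<Rightarrow> real mat \<Rightarrow> real mat \<Rightarrow> real vec \<Rightarrow> real vec \<Rightarrow> real vec \<Rightarrow> nat set" where
  "I_plus n M Q r x z = {i \<in> {0..<n}. x $ i > 0 \<and> residual M Q r x z $ i > 0}"

text \<open>
  The index \<open>i\<^sub>l\<close> is written \<open>ind l\<close>, and \<open>\<delta> \<in> {0,1}\<^sup>s\<close> is a function on \<open>{1..s}\<close>.
  The objective function of the branch problem is constantly \<open>0\<close>, hence only its region is recorded.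
\<close>

definition binary_vectors :: "nat \<Rightarrow> (nat \<Rightarrow> nat) set" where
  "binary_vectors s = {1..s} \<rightarrow>\<^sub>E {0, 1}"

definition branch_region ::
  "nat \<Rightarrow> nat \<Rightarrow> real mat \<Rightarrow> real mat \<Rightarrow> real mat \<Rightarrow> real mat \<Rightarrow> real vec \<Rightarrow> real vec \<Rightarrow>
   nat \<Rightarrow> (nat \<Rightarrow> nat) \<Rightarrow> (nat \<Rightarrow> nat) \<Rightarrow> point set" where
  "branch_region n m M Q A B r b s ind \<delta> =
     {(x, z) \<in> relaxed_region n m M Q A B r b.
        \<forall>l\<in>{1..s}. (\<delta> l = 0 \<longrightarrow> x $ ind l = 0) \<and>
                    (\<delta> l = 1 \<longrightarrow> residual M Q r x z $ ind l = 0)}"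

definition branch_feasible ::
  "nat \<Rightarrow> nat \<Rightarrow> real mat \<Rightarrow> real mat \<Rightarrow> real mat \<Rightarrow> real mat \<Rightarrow> real vec \<Rightarrow> real vec \<Rightarrow>
   nat \<Rightarrow> (nat \<Rightarrow> nat) \<Rightarrow> (nat \<Rightarrow> nat) \<Rightarrow> bool" where
  "branch_feasible n m M Q A B r b s ind \<delta> \<longleftrightarrow> branch_region n m M Q A B r b s ind \<delta> \<noteq> {}"

end

theory Submission
  imports Defs
begin

text \<open>
  Among nonnegative vectors, orthogonality is componentwise: a vanishing sum of nonnegative products
  has only vanishing terms. A solution \<open>(x, z)\<close> of the SLCC therefore satisfies, at every index
  \<open>i\<close>, at least one of \<open>x\<^sub>i = 0\<close> and \<open>(Mx + Qz - r)\<^sub>i = 0\<close>. Recording at each branching index which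
  of the two occurs yields a \<open>\<delta>\<close> for which this same point lies in the branch region
  (\<open>branch_region_covers_slcc_solution\<close>). The second claim of the theorem is the contrapositive of
  the first.
\<close>

lemma scalar_prod_nonneg_eq_0_iff:
  fixes u v :: "real vec"
  assumes "0\<^sub>v n \<le> u" and "0\<^sub>v n \<le> v"
  shows "u \<bullet> v = 0 \<longleftrightarrow> (\<forall>i<n. u $ i = 0 \<or> v $ i = 0)"
proof -
  have nonneg: "\<forall>i\<in>{0..<n}. 0 \<le> u $ i * v $ i" and dim: "dim_vec v = n"
    using assms by (auto simp: less_eq_vec_def)
  have "u \<bullet> v = (\<Sum>i\<in>{0..<n}. u $ i * v $ i)"
    by (simp add: scalar_prod_def dim)
  then show ?thesis
    using nonneg sum_nonneg_eq_0_iff[of "{0..<n}" "\<lambda>i. u $ i * v $ i"] by auto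
qed

lemma nonneg_residual_iff:
  assumes "M \<in> carrier_mat n k" and "Q \<in> carrier_mat n m" and "r \<in> carrier_vec n"
  shows "0\<^sub>v n \<le> residual M Q r x z \<longleftrightarrow> r \<le> M *\<^sub>v x + Q *\<^sub>v z"
  using assms by (auto simp: residual_def less_eq_vec_def)

text \<open>
  This turns the bilinear complementarity equation into \<open>n\<close> disjunctions of linear equations, the
  form on which branching acts.
\<close>

lemma slcc_solutions_iff:
  assumes "M \<in> carrier_mat n n" and "Q \<in> carrier_mat n m" and "r \<in> carrier_vec n"
  shows "(x, z) \<in> slcc_solutions n m M Q A B r b \<longleftrightarrow>
    (x, z) \<in> relaxed_region n m M Q A B r b \<and>
    (\<forall>i<n. x $ i = 0 \<or> residual M Q r x z $ i = 0)"
  using nonneg_residual_iff[OF assms, of x z] scalar_prod_nonneg_eq_0_iff[of n x "residual M Q r x z"]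
  by (auto simp: slcc_solutions_def relaxed_region_def)

lemma branch_region_covers_slcc_solution:
  assumes "M \<in> carrier_mat n n" and "Q \<in> carrier_mat n m" and "r \<in> carrier_vec n"
    and ind: "ind ` {1..s} \<subseteq> {0..<n}"
    and sol: "(x, z) \<in> slcc_solutions n m M Q A B r b"
  shows "\<exists>\<delta>\<in>binary_vectors s. (x, z) \<in> branch_region n m M Q A B r b s ind \<delta>"
proof
  \<comment> \<open>At a degenerate index both components vanish and either value would do; this choice takes \<open>0\<close>.\<close>
  let ?\<delta> = "\<lambda>l\<in>{1..s}. if x $ ind l = 0 then 0 else 1 :: nat"
  show "?\<delta> \<in> binary_vectors s"
    by (auto simp: binary_vectors_def)
  have "(x, z) \<in> relaxed_region n m M Q A B r b"
    and compl: "\<forall>i<n. x $ i = 0 \<or> residual M Q r x z $ i = 0"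
    using sol slcc_solutions_iff[OF assms(1-3)] by auto
  moreover have "x $ ind l = 0 \<or> residual M Q r x z $ ind l = 0" if "l \<in> {1..s}" for l
    using compl ind that by (auto simp: image_subset_iff)
  ultimately show "(x, z) \<in> branch_region n m M Q A B r b s ind ?\<delta>"
    by (fastforce simp: branch_region_def)
qed

theorem proposition4p6:
  fixes n m p s :: nat
    and M Q A B :: "real mat"
    and r b xs zs :: "real vec"
    and ind :: "nat \<Rightarrow> nat"
  assumes "M \<in> carrier_mat n n" and "Q \<in> carrier_mat n m"
    and "A \<in> carrier_mat p n" and "B \<in> carrier_mat p m"
    and "r \<in> carrier_vec n" and "b \<in> carrier_vec p"
    and "\<exists>cx\<in>carrier_vec n. \<exists>cz\<in>carrier_vec m. lp_optimal n m M Q A B r b cx cz (xs, zs)"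
    and "s = card (I_plus n M Q r xs zs)"
    and "bij_betw ind {1..s} (I_plus n M Q r xs zs)"
  shows "(slcc_feasible n m M Q A B r b \<longrightarrow>
            (\<exists>\<delta>\<in>binary_vectors s. branch_feasible n m M Q A B r b s ind \<delta>)) \<and>
         ((\<forall>\<delta>\<in>binary_vectors s. \<not> branch_feasible n m M Q A B r b s ind \<delta>) \<longrightarrow>
            \<not> slcc_feasible n m M Q A B r b)"
proof -
  have "ind ` {1..s} \<subseteq> {0..<n}"
    using assms(9) by (auto simp: bij_betw_def I_plus_def)
  then have "\<exists>\<delta>\<in>binary_vectors s. branch_feasible n m M Q A B r b s ind \<delta>"
    if "slcc_feasible n m M Q A B r b"
    using that branch_region_covers_slcc_solution[OF assms(1,2,5)]
    unfolding slcc_feasible_def branch_feasible_def by fast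
  then show ?thesis
    by blast
qed

end
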